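(* Let $R$ be a commutative noetherian ring, let $\mathcal{S}$ be a Serre subcategory of $R$-Mod and let $\mathfrak{a}$ be an ideal of $R$. Then $\mathcal{S}_{\mathfrak{a}}$ is closed under taking extensions of modules.
   Context: $R$-Mod is the category of $R$-modules; all subcategories are full (identified with their classes of objects). A subcategory is Serre if it is closed under taking submodules, quotients and extensions. For an ideal $\mathfrak{a}$ and an $R$-module $M$, $\Gamma_{\mathfrak{a}}(M)=\{m\in M : \mathfrak{a}^k m=0 \text{ for some } k\ge 1\}$ and $(0:_M\mathfrak{a})=\{m\in M:\mathfrak{a}m=0\}$. A class $\mathcal{S}$ of $R$-modules satisfies the $C_{\mathfrak{a}}$ condition on an $R$-module $M$ if: $\Gamma_{\mathfrak{a}}(M)=M$ and $(0:_M\mathfrak{a})\in\mathcal{S}$ imply $M\in\mathcal{S}$; it satisfies the $C_{\mathfrak{a}}$ condition on a class $\mathcal{D}$ if it does so on every $M\in\mathcal{D}$. $\mathcal{S}_{\mathfrak{a}}$ denotes the largest subclass of $R$-Mod such that $\mathcal{S}$ satisfies the $C_{\mathfrak{a}}$ condition on $\mathcal{S}_{\mathfrak{a}}$, i.e. the class of all $R$-modules $M$ such that $\mathcal{S}$ satisfies the $C_{\mathfrak{a}}$ condition on $M$. *)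

theory Defs
  imports "HOL-Algebra.Algebra"
begin

text \<open>
  R-Mod is modelled as the collection of all modules over \<open>R\<close> whose carrier is a set of elements
  of a type \<open>'m\<close>. The type \<open>'m\<close> plays the role of a universe; it is a free type variable, so
  statements about R-Mod hold for every choice of it. A (full) subcategory is a set of such modules.
\<close>

definition Mods :: "('r, 'k) ring_scheme \<Rightarrow> ('r, 'm) module set" where
  "Mods R = {M. module R M}"

definition module_hom ::
  "('r, 'k) ring_scheme \<Rightarrow> ('r, 'm) module \<Rightarrow> ('r, 'm) module \<Rightarrow> ('m \<Rightarrow> 'm) set" where
  "module_hom R M N = {f \<in> hom (add_monoid M) (add_monoid N).
     \<forall>r \<in> carrier R. \<forall>x \<in> carrier M. f (r \<odot>\<^bsub>M\<^esub> x) = r \<odot>\<^bsub>N\<^esub> f x}"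

definition short_exact ::
  "('r, 'k) ring_scheme \<Rightarrow> ('r, 'm) module \<Rightarrow> ('m \<Rightarrow> 'm) \<Rightarrow> ('r, 'm) module \<Rightarrow> ('m \<Rightarrow> 'm) \<Rightarrow>
    ('r, 'm) module \<Rightarrow> bool" where
  "short_exact R L f M g N \<longleftrightarrow>
     f \<in> module_hom R L M \<and> g \<in> module_hom R M N \<and>
     inj_on f (carrier L) \<and> f ` carrier L = a_kernel M N g \<and> g ` carrier M = carrier N"

definition closed_under_submodules ::
  "('r, 'k) ring_scheme \<Rightarrow> ('r, 'm) module set \<Rightarrow> bool" where
  "closed_under_submodules R S \<longleftrightarrow>
     (\<forall>M \<in> S. \<forall>H. submodule H R M \<longrightarrow> M\<lparr>carrier := H\<rparr> \<in> S)"

text \<open>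
  The quotients of \<open>M\<close> are taken up to isomorphism, as the homomorphic images of \<open>M\<close>: the cosets
  of a submodule form a module over the type \<open>'m set\<close>, which is not an element of \<open>Mods R\<close>.
  In particular, closure under quotients includes closure under isomorphism.
\<close>

definition closed_under_quotients ::
  "('r, 'k) ring_scheme \<Rightarrow> ('r, 'm) module set \<Rightarrow> bool" where
  "closed_under_quotients R S \<longleftrightarrow>
     (\<forall>M \<in> S. \<forall>N \<in> Mods R. \<forall>g \<in> module_hom R M N. g ` carrier M = carrier N \<longrightarrow> N \<in> S)"

definition closed_under_extensions ::
  "('r, 'k) ring_scheme \<Rightarrow> ('r, 'm) module set \<Rightarrow> bool" where
  "closed_under_extensions R S \<longleftrightarrow>
     (\<forall>L \<in> S. \<forall>N \<in> S. \<forall>M \<in> Mods R. \<forall>f g. short_exact R L f M g N \<longrightarrow> M \<in> S)"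

definition serre_subcategory ::
  "('r, 'k) ring_scheme \<Rightarrow> ('r, 'm) module set \<Rightarrow> bool" where
  "serre_subcategory R S \<longleftrightarrow> S \<subseteq> Mods R \<and>
     closed_under_submodules R S \<and> closed_under_quotients R S \<and> closed_under_extensions R S"

text \<open>The powers of an ideal are taken in the multiplicative monoid of the ideals of \<open>R\<close>.\<close>

definition torsion ::
  "('r, 'k) ring_scheme \<Rightarrow> 'r set \<Rightarrow> ('r, 'm) module \<Rightarrow> 'm set" where
  "torsion R \<aa> M = {m \<in> carrier M.
     \<exists>k::nat. k \<ge> 1 \<and> (\<forall>r \<in> \<aa> [^]\<^bsub>ideals_set R\<^esub> k. r \<odot>\<^bsub>M\<^esub> m = \<zero>\<^bsub>M\<^esub>)}"

definition annihilated ::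
  "'r set \<Rightarrow> ('r, 'm) module \<Rightarrow> 'm set" where
  "annihilated \<aa> M = {m \<in> carrier M. \<forall>r \<in> \<aa>. r \<odot>\<^bsub>M\<^esub> m = \<zero>\<^bsub>M\<^esub>}"

definition C_condition ::
  "('r, 'k) ring_scheme \<Rightarrow> ('r, 'm) module set \<Rightarrow> 'r set \<Rightarrow> ('r, 'm) module \<Rightarrow> bool" where
  "C_condition R S \<aa> M \<longleftrightarrow>
     (torsion R \<aa> M = carrier M \<and> M\<lparr>carrier := annihilated \<aa> M\<rparr> \<in> S \<longrightarrow> M \<in> S)"

definition C_condition_on ::
  "('r, 'k) ring_scheme \<Rightarrow> ('r, 'm) module set \<Rightarrow> 'r set \<Rightarrow> ('r, 'm) module set \<Rightarrow> bool" where
  "C_condition_on R S \<aa> D \<longleftrightarrow> (\<forall>M \<in> D. C_condition R S \<aa> M)"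

definition C_class ::
  "('r, 'k) ring_scheme \<Rightarrow> ('r, 'm) module set \<Rightarrow> 'r set \<Rightarrow> ('r, 'm) module set" where
  "C_class R S \<aa> = {M \<in> Mods R. C_condition R S \<aa> M}"

lemma C_class_greatest:
  "C_class R S \<aa> \<subseteq> Mods R" "C_condition_on R S \<aa> (C_class R S \<aa>)"
  "D \<subseteq> Mods R \<Longrightarrow> C_condition_on R S \<aa> D \<Longrightarrow> D \<subseteq> C_class R S \<aa>"
  by (auto simp: C_class_def C_condition_on_def)

end

theory Submission
  imports Defs
begin

text \<open>
  Let \<open>0 \<rightarrow> L \<rightarrow> M \<rightarrow> N \<rightarrow> 0\<close> be exact with \<open>L\<close> and \<open>N\<close> in the class \<open>S\<^sub>\<aa>\<close>, and let \<open>M\<close> be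
  \<open>\<aa>\<close>-torsion with \<open>(0 :\<^sub>M \<aa>)\<close> in \<open>S\<close>. Torsion passes to \<open>L\<close> and to \<open>N\<close>, and \<open>(0 :\<^sub>L \<aa>)\<close> embeds into
  \<open>(0 :\<^sub>M \<aa>)\<close>, so the condition on \<open>L\<close> puts \<open>L\<close> into \<open>S\<close>.
  The difficulty is to see that \<open>(0 :\<^sub>N \<aa>)\<close> lies in \<open>S\<close> as well:
  the map \<open>(0 :\<^sub>M \<aa>) \<rightarrow> (0 :\<^sub>N \<aa>)\<close> is usually not onto, and its cokernel embeds into
  \<open>Ext\<^sup>1(R/\<aa>, L)\<close>, which is in \<open>S\<close> because \<open>R\<close> is noetherian and \<open>L\<close> is in \<open>S\<close>.

  A direct argument replaces this appeal to Ext. The preimage \<open>K\<close> of \<open>(0 :\<^sub>N \<aa>)\<close> in \<open>M\<close> consists of the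
  elements that \<open>\<aa>\<close> multiplies into the image \<open>T\<close> of \<open>L\<close>. Let \<open>r\<^sub>1, \<dots>, r\<^sub>n\<close> generate \<open>\<aa>\<close>. Then
  \<open>m \<mapsto> (r\<^sub>1 m, \<dots>, r\<^sub>n m)\<close> maps \<open>K\<close> to \<open>T\<^sup>n\<close> with kernel \<open>(0 :\<^sub>M \<aa>)\<close>, so \<open>K\<close> is in \<open>S\<close>, and then so is
  its quotient \<open>(0 :\<^sub>N \<aa>)\<close>. Hence \<open>N\<close> is in \<open>S\<close> by its own condition, and finally \<open>M\<close> is, as an extension of \<open>N\<close> by \<open>L\<close>.
  Lemma \<open>serre_if_finite_multiplication_into_serre\<close> carries out the step about \<open>K\<close> one generator at a
  time, so that only submodules of \<open>M\<close> itself occur and the power \<open>T\<^sup>n\<close> is never formed.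
\<close>

section \<open>Homomorphisms and submodules\<close>

lemma module_homI:
  assumes "\<And>x. x \<in> carrier M \<Longrightarrow> f x \<in> carrier N"
    and "\<And>x y. x \<in> carrier M \<Longrightarrow> y \<in> carrier M \<Longrightarrow> f (x \<oplus>\<^bsub>M\<^esub> y) = f x \<oplus>\<^bsub>N\<^esub> f y"
    and "\<And>r x. r \<in> carrier R \<Longrightarrow> x \<in> carrier M \<Longrightarrow> f (r \<odot>\<^bsub>M\<^esub> x) = r \<odot>\<^bsub>N\<^esub> f x"
  shows "f \<in> module_hom R M N"
  using assms by (simp add: module_hom_def hom_def)

lemma module_homD:
  assumes "f \<in> module_hom R M N"
  shows module_hom_closed: "x \<in> carrier M \<Longrightarrow> f x \<in> carrier N"
    and module_hom_add:
      "x \<in> carrier M \<Longrightarrow> y \<in> carrier M \<Longrightarrow> f (x \<oplus>\<^bsub>M\<^esub> y) = f x \<oplus>\<^bsub>N\<^esub> f y"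
    and module_hom_smult:
      "r \<in> carrier R \<Longrightarrow> x \<in> carrier M \<Longrightarrow> f (r \<odot>\<^bsub>M\<^esub> x) = r \<odot>\<^bsub>N\<^esub> f x"
  using assms by (auto simp: module_hom_def hom_def)

lemma module_hom_zero:
  assumes "module R M" "module R N" "f \<in> module_hom R M N"
  shows "f \<zero>\<^bsub>M\<^esub> = \<zero>\<^bsub>N\<^esub>"
proof -
  interpret M: module R M by fact
  interpret N: module R N by fact
  have "f \<zero>\<^bsub>M\<^esub> = f (\<zero>\<^bsub>R\<^esub> \<odot>\<^bsub>M\<^esub> \<zero>\<^bsub>M\<^esub>)" by simp
  also have "\<dots> = \<zero>\<^bsub>R\<^esub> \<odot>\<^bsub>N\<^esub> f \<zero>\<^bsub>M\<^esub>" using module_hom_smult[OF assms(3)] by blast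
  also have "\<dots> = \<zero>\<^bsub>N\<^esub>" using module_hom_closed[OF assms(3)] by simp
  finally show ?thesis .
qed

lemma (in module) submodule_criterion:
  assumes "H \<subseteq> carrier M" "\<zero>\<^bsub>M\<^esub> \<in> H"
    and "\<And>x y. x \<in> H \<Longrightarrow> y \<in> H \<Longrightarrow> x \<oplus>\<^bsub>M\<^esub> y \<in> H"
    and smult: "\<And>r x. r \<in> carrier R \<Longrightarrow> x \<in> H \<Longrightarrow> r \<odot>\<^bsub>M\<^esub> x \<in> H"
  shows "submodule H R M"
proof (rule submoduleI)
  fix x assume x: "x \<in> H"
  then have "(\<ominus>\<^bsub>R\<^esub> \<one>\<^bsub>R\<^esub>) \<odot>\<^bsub>M\<^esub> x = \<ominus>\<^bsub>M\<^esub> x"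
    using assms(1) by (simp add: smult_l_minus subset_iff)
  then show "\<ominus>\<^bsub>M\<^esub> x \<in> H"
    using smult[of "\<ominus>\<^bsub>R\<^esub> \<one>\<^bsub>R\<^esub>" x] x by simp
qed (use assms in auto)

lemma (in module) submodule_zero_closed:
  assumes "submodule H R M"
  shows "\<zero>\<^bsub>M\<^esub> \<in> H"
proof -
  obtain x where "x \<in> H" using submoduleE(2)[OF assms] by blast
  then show ?thesis
    using submoduleE(1)[OF assms] submoduleE(4)[OF assms R.zero_closed] by force
qed

lemma submodule_image:
  assumes "module R M" "module R N" "f \<in> module_hom R M N" "submodule H R M"
  shows "submodule (f ` H) R N"
proof -
  interpret M: module R M by fact
  interpret N: module R N by fact
  note H = M.submoduleE[OF assms(4)] and f = module_homD[OF assms(3)]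
  show ?thesis
  proof (rule N.submodule_criterion)
    show "f ` H \<subseteq> carrier N" using H(1) f(1) by blast
    show "\<zero>\<^bsub>N\<^esub> \<in> f ` H"
      using M.submodule_zero_closed[OF assms(4)] module_hom_zero[OF assms(1-3)] by (metis imageI)
    show "x \<oplus>\<^bsub>N\<^esub> y \<in> f ` H" if "x \<in> f ` H" "y \<in> f ` H" for x y
      using that H(1,5) f(2) by (smt (verit, best) image_iff subsetD)
    show "r \<odot>\<^bsub>N\<^esub> x \<in> f ` H" if "r \<in> carrier R" "x \<in> f ` H" for r x
      using that H(1,4) f(3) by (smt (verit, best) image_iff subsetD)
  qed
qed

lemma submodule_preimage:
  assumes "module R M" "module R N" "f \<in> module_hom R M N" "submodule H R M" "submodule K R N"
  shows "submodule {x \<in> H. f x \<in> K} R M"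
proof -
  interpret M: module R M by fact
  interpret N: module R N by fact
  note H = M.submoduleE[OF assms(4)] and f = module_homD[OF assms(3)]
  note K = N.submoduleE[OF assms(5)]
  show ?thesis
  proof (rule M.submodule_criterion)
    show "\<zero>\<^bsub>M\<^esub> \<in> {x \<in> H. f x \<in> K}"
      using M.submodule_zero_closed[OF assms(4)] N.submodule_zero_closed[OF assms(5)]
        module_hom_zero[OF assms(1-3)] by simp
  qed (use H K f in \<open>auto simp: subset_iff\<close>)
qed

lemma (in module) zero_submodule: "submodule {\<zero>\<^bsub>M\<^esub>} R M"
  by (rule submodule_criterion) auto

lemma module_hom_restrict:
  assumes "f \<in> module_hom R M N" "H \<subseteq> carrier M" "f ` H \<subseteq> K"
  shows "f \<in> module_hom R (M\<lparr>carrier := H\<rparr>) (N\<lparr>carrier := K\<rparr>)"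
  using module_homD[OF assms(1)] assms(2,3) by (intro module_homI) (auto simp: subset_iff)

lemma smult_module_hom:
  assumes "module R M" "r \<in> carrier R"
  shows "(\<lambda>x. r \<odot>\<^bsub>M\<^esub> x) \<in> module_hom R M M"
proof -
  interpret module R M by fact
  show ?thesis
  proof (rule module_homI)
    fix s x assume "s \<in> carrier R" "x \<in> carrier M"
    then show "r \<odot>\<^bsub>M\<^esub> (s \<odot>\<^bsub>M\<^esub> x) = s \<odot>\<^bsub>M\<^esub> (r \<odot>\<^bsub>M\<^esub> x)"
      using assms(2) by (simp flip: smult_assoc1 add: R.m_comm)
  qed (use assms(2) in \<open>auto simp: smult_r_distr\<close>)
qed

section \<open>Annihilators\<close>

lemma annihilated_submodule:
  assumes "module R M" "\<aa> \<subseteq> carrier R"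
  shows "submodule (annihilated \<aa> M) R M"
proof -
  interpret module R M by fact
  show ?thesis
  proof (rule submodule_criterion)
    fix s x assume s: "s \<in> carrier R" and x: "x \<in> annihilated \<aa> M"
    have "r \<odot>\<^bsub>M\<^esub> (s \<odot>\<^bsub>M\<^esub> x) = \<zero>\<^bsub>M\<^esub>" if "r \<in> \<aa>" for r
    proof -
      have "r \<odot>\<^bsub>M\<^esub> (s \<odot>\<^bsub>M\<^esub> x) = s \<odot>\<^bsub>M\<^esub> (r \<odot>\<^bsub>M\<^esub> x)"
        using module_hom_smult[OF smult_module_hom[OF assms(1)], of r s x] assms(2) that s x
        by (auto simp: annihilated_def)
      then show ?thesis using that s x by (simp add: annihilated_def)
    qed
    then show "s \<odot>\<^bsub>M\<^esub> x \<in> annihilated \<aa> M" using s x by (simp add: annihilated_def)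
  qed (use assms(2) in \<open>auto simp: annihilated_def subset_iff smult_r_distr\<close>)
qed

text \<open>The scalars that kill a given element form an ideal, so killing generators suffices.\<close>

lemma annihilated_genideal:
  assumes "module R M" "A \<subseteq> carrier R"
  shows "annihilated (Idl\<^bsub>R\<^esub> A) M = annihilated A M"
proof
  interpret module R M by fact
  show "annihilated (Idl\<^bsub>R\<^esub> A) M \<subseteq> annihilated A M"
    using R.genideal_self[OF assms(2)] by (auto simp: annihilated_def)
  show "annihilated A M \<subseteq> annihilated (Idl\<^bsub>R\<^esub> A) M"
  proof
    fix x assume x: "x \<in> annihilated A M"
    then have xM: "x \<in> carrier M" by (simp add: annihilated_def)
    let ?I = "{r \<in> carrier R. r \<odot>\<^bsub>M\<^esub> x = \<zero>\<^bsub>M\<^esub>}"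
    have "ideal ?I R"
    proof (rule idealI)
      show "ring R" by (rule R.ring_axioms)
      show "subgroup ?I (add_monoid R)"
        using xM
        by (intro subgroup.intro) (auto simp: smult_l_distr smult_l_minus simp flip: a_inv_def)
      show "s \<otimes>\<^bsub>R\<^esub> r \<in> ?I" if "r \<in> ?I" "s \<in> carrier R" for r s
        using that xM by (simp add: smult_assoc1)
      show "r \<otimes>\<^bsub>R\<^esub> s \<in> ?I" if "r \<in> ?I" "s \<in> carrier R" for r s
        using that xM by (simp add: smult_assoc1 R.m_comm[of r s])
    qed
    then have "Idl\<^bsub>R\<^esub> A \<subseteq> ?I"
      using x assms(2) by (intro R.genideal_minimal) (auto simp: annihilated_def)
    then show "x \<in> annihilated (Idl\<^bsub>R\<^esub> A) M"
      using xM by (auto simp: annihilated_def)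
  qed
qed

section \<open>Torsion along homomorphisms\<close>

lemma ideal_power_subset:
  assumes "cring R" "ideal \<aa> R"
  shows "\<aa> [^]\<^bsub>ideals_set R\<^esub> (k::nat) \<subseteq> carrier R"
proof -
  interpret R: cring R by fact
  interpret I: comm_monoid "ideals_set R" by (rule R.ideals_set_is_comm_monoid)
  have "\<aa> [^]\<^bsub>ideals_set R\<^esub> k \<in> carrier (ideals_set R)"
    using assms(2) by (intro I.nat_pow_closed) (simp add: ideals_set_def)
  then have "ideal (\<aa> [^]\<^bsub>ideals_set R\<^esub> k) R" by (simp add: ideals_set_def)
  then show ?thesis by (rule additive_subgroup.a_subset[OF ideal.axioms(1)])
qed

lemma torsion_surjective:
  assumes "cring R" "ideal \<aa> R" "module R M" "module R N" "g \<in> module_hom R M N"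
    and "g ` carrier M = carrier N" "torsion R \<aa> M = carrier M"
  shows "torsion R \<aa> N = carrier N"
proof -
  have "y \<in> torsion R \<aa> N" if y: "y \<in> carrier N" for y
  proof -
    obtain x where x: "x \<in> carrier M" "y = g x" using y assms(6) by blast
    then obtain k :: nat where k: "k \<ge> 1" "\<forall>r \<in> \<aa> [^]\<^bsub>ideals_set R\<^esub> k. r \<odot>\<^bsub>M\<^esub> x = \<zero>\<^bsub>M\<^esub>"
      using assms(7) unfolding torsion_def by blast
    have "r \<odot>\<^bsub>N\<^esub> y = \<zero>\<^bsub>N\<^esub>" if "r \<in> \<aa> [^]\<^bsub>ideals_set R\<^esub> k" for r
      using that k(2) x ideal_power_subset[OF assms(1,2), of k]
        module_hom_smult[OF assms(5), of r x] module_hom_zero[OF assms(3-5)]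
      by auto
    then show ?thesis using y k(1) unfolding torsion_def by blast
  qed
  then show ?thesis unfolding torsion_def by blast
qed

lemma smult_zero_if_injective:
  assumes "module R L" "module R M" "f \<in> module_hom R L M" "inj_on f (carrier L)"
    and "r \<in> carrier R" "x \<in> carrier L" "r \<odot>\<^bsub>M\<^esub> f x = \<zero>\<^bsub>M\<^esub>"
  shows "r \<odot>\<^bsub>L\<^esub> x = \<zero>\<^bsub>L\<^esub>"
proof -
  interpret L: module R L by fact
  have "f (r \<odot>\<^bsub>L\<^esub> x) = f \<zero>\<^bsub>L\<^esub>"
    using assms(5-7) module_hom_smult[OF assms(3)] module_hom_zero[OF assms(1-3)] by simp
  then show ?thesis using assms(4-6) by (simp add: inj_on_eq_iff)
qed

lemma torsion_injective:
  assumes "cring R" "ideal \<aa> R" "module R L" "module R M" "f \<in> module_hom R L M"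
    and "inj_on f (carrier L)" "torsion R \<aa> M = carrier M"
  shows "torsion R \<aa> L = carrier L"
proof -
  have "x \<in> torsion R \<aa> L" if x: "x \<in> carrier L" for x
  proof -
    have "f x \<in> torsion R \<aa> M"
      using x module_hom_closed[OF assms(5)] assms(7) by blast
    then obtain k :: nat where k: "k \<ge> 1" "\<forall>r \<in> \<aa> [^]\<^bsub>ideals_set R\<^esub> k. r \<odot>\<^bsub>M\<^esub> f x = \<zero>\<^bsub>M\<^esub>"
      unfolding torsion_def by blast
    have "\<forall>r \<in> \<aa> [^]\<^bsub>ideals_set R\<^esub> k. r \<odot>\<^bsub>L\<^esub> x = \<zero>\<^bsub>L\<^esub>"
      using k(2) x ideal_power_subset[OF assms(1,2), of k]
        smult_zero_if_injective[OF assms(3-6)] by blast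
    then show ?thesis using x k(1) unfolding torsion_def by blast
  qed
  then show ?thesis unfolding torsion_def by blast
qed

section \<open>Serre subcategories\<close>

lemma serre_module:
  assumes "serre_subcategory R S" "M \<in> S"
  shows "module R M"
  using assms by (auto simp: serre_subcategory_def Mods_def)

lemma serre_surjective:
  assumes "serre_subcategory R S" "M \<in> S" "module R N"
    and "g \<in> module_hom R M N" "g ` carrier M = carrier N"
  shows "N \<in> S"
  using assms unfolding serre_subcategory_def closed_under_quotients_def Mods_def by blast

lemma serre_extension:
  assumes "serre_subcategory R S" "L \<in> S" "N \<in> S" "module R M" "short_exact R L f M g N"
  shows "M \<in> S"
  using assms unfolding serre_subcategory_def closed_under_extensions_def Mods_def by blast

lemma serre_image:
  assumes "serre_subcategory R S" "module R M" "module R N" "g \<in> module_hom R M N"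
    and "submodule H R M" "M\<lparr>carrier := H\<rparr> \<in> S"
  shows "N\<lparr>carrier := g ` H\<rparr> \<in> S"
proof (rule serre_surjective[OF assms(1,6)])
  show "module R (N\<lparr>carrier := g ` H\<rparr>)"
    using submodule_image[OF assms(2-5)] assms(3) by (rule submodule.submodule_is_module)
  show "g \<in> module_hom R (M\<lparr>carrier := H\<rparr>) (N\<lparr>carrier := g ` H\<rparr>)"
    using module.submoduleE(1)[OF assms(2,5)] by (intro module_hom_restrict[OF assms(4)]) auto
qed simp

lemma serre_submodule_of_submodule:
  assumes "serre_subcategory R S" "module R M" "submodule T R M" "M\<lparr>carrier := T\<rparr> \<in> S"
    and "submodule H R M" "H \<subseteq> T"
  shows "M\<lparr>carrier := H\<rparr> \<in> S"
proof -
  have "module R (M\<lparr>carrier := H\<rparr>)"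
    using assms(5,2) by (rule submodule.submodule_is_module)
  then have "submodule H R (M\<lparr>carrier := T\<rparr>)"
    using assms(6)
    by (intro module.module_incl_imp_submodule[OF serre_module[OF assms(1,4)]]) auto
  then have "M\<lparr>carrier := T, carrier := H\<rparr> \<in> S"
    using assms(1,4) unfolding serre_subcategory_def closed_under_submodules_def by blast
  then show ?thesis by simp
qed

text \<open>
  Closure under submodules concerns subsets of the carrier. A module that merely embeds into a member
  of \<open>S\<close> is the image of such a submodule under the inverse of the embedding.
\<close>

lemma serre_injective:
  assumes "serre_subcategory R S" "B \<in> S" "module R A"
    and "f \<in> module_hom R A B" "inj_on f (carrier A)"
  shows "A \<in> S"
proof -
  interpret A: module R A by fact
  note B = serre_module[OF assms(1,2)]
  have sub: "submodule (f ` carrier A) R B"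
    using assms(3) B assms(4) A.carrier_is_submodule by (rule submodule_image)
  have "B\<lparr>carrier := f ` carrier A\<rparr> \<in> S"
    using assms(1,2) sub unfolding serre_subcategory_def closed_under_submodules_def by blast
  moreover have "inv_into (carrier A) f \<in> module_hom R (B\<lparr>carrier := f ` carrier A\<rparr>) A"
    by (rule module_homI)
      (use assms(5) in \<open>auto simp: inv_into_into inv_into_f_eq
        simp flip: module_hom_add[OF assms(4)] module_hom_smult[OF assms(4)]\<close>)
  moreover have "inv_into (carrier A) f ` f ` carrier A = carrier A"
    using assms(5) by (simp add: inv_into_image_cancel)
  ultimately show ?thesis
    by (intro serre_surjective[OF assms(1) _ assms(3), where g = "inv_into (carrier A) f"]) auto
qed

lemma serre_kernel_image:
  assumes "serre_subcategory R S" "module R M" "module R N" "g \<in> module_hom R M N"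
    and "submodule K R M"
    and "M\<lparr>carrier := {x \<in> K. g x = \<zero>\<^bsub>N\<^esub>}\<rparr> \<in> S" "N\<lparr>carrier := g ` K\<rparr> \<in> S"
  shows "M\<lparr>carrier := K\<rparr> \<in> S"
proof (rule serre_extension[OF assms(1,6,7)])
  have KM: "K \<subseteq> carrier M" by (rule module.submoduleE(1)[OF assms(2,5)])
  show "module R (M\<lparr>carrier := K\<rparr>)"
    using assms(5,2) by (rule submodule.submodule_is_module)
  show "short_exact R (M\<lparr>carrier := {x \<in> K. g x = \<zero>\<^bsub>N\<^esub>}\<rparr>) (\<lambda>x. x) (M\<lparr>carrier := K\<rparr>) g
      (N\<lparr>carrier := g ` K\<rparr>)"
    using module_hom_restrict[OF assms(4) KM order_refl]
    by (auto simp: short_exact_def a_kernel_def' intro!: module_homI)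
qed

section \<open>Extensions and the annihilator condition\<close>

text \<open>
  Multiplication by a generator \<open>r\<close> exhibits \<open>K\<close> as an extension of \<open>r K\<close>, a submodule of \<open>T\<close>, by the
  part of \<open>K\<close> that \<open>r\<close> kills. The remaining generators multiply this part into \<open>T\<close> as well, so
  induction on the number of generators applies to it.
\<close>

lemma serre_if_finite_multiplication_into_serre:
  assumes "serre_subcategory R S" "module R M" "submodule T R M" "M\<lparr>carrier := T\<rparr> \<in> S"
    and "finite A" "A \<subseteq> carrier R" "submodule K R M"
    and "\<And>r x. r \<in> A \<Longrightarrow> x \<in> K \<Longrightarrow> r \<odot>\<^bsub>M\<^esub> x \<in> T"
    and "M\<lparr>carrier := K \<inter> annihilated A M\<rparr> \<in> S"
  shows "M\<lparr>carrier := K\<rparr> \<in> S"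
  using assms(5-9)
proof (induction A arbitrary: K)
  case empty
  then have "K \<inter> annihilated {} M = K"
    using module.submoduleE(1)[OF assms(2)] by (auto simp: annihilated_def)
  then show ?case using empty by simp
next
  case (insert r A)
  interpret M: module R M by (rule assms(2))
  let ?K' = "{x \<in> K. r \<odot>\<^bsub>M\<^esub> x = \<zero>\<^bsub>M\<^esub>}"
  have r: "r \<in> carrier R" using insert.prems(1) by blast
  have hom: "(\<lambda>x. r \<odot>\<^bsub>M\<^esub> x) \<in> module_hom R M M"
    by (rule smult_module_hom[OF assms(2) r])
  have K': "submodule ?K' R M"
    using submodule_preimage[OF assms(2,2) hom insert.prems(2) M.zero_submodule]
    unfolding singleton_iff .
  have "?K' \<inter> annihilated A M = K \<inter> annihilated (insert r A) M"
    by (auto simp: annihilated_def)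
  then have "M\<lparr>carrier := ?K' \<inter> annihilated A M\<rparr> \<in> S" using insert.prems(4) by simp
  then have kernel: "M\<lparr>carrier := ?K'\<rparr> \<in> S"
    using insert.prems(1,3) by (intro insert.IH[OF _ K']) blast+
  have image: "M\<lparr>carrier := (\<lambda>x. r \<odot>\<^bsub>M\<^esub> x) ` K\<rparr> \<in> S"
    using insert.prems(3)
    by (intro serre_submodule_of_submodule[OF assms(1-4)
          submodule_image[OF assms(2,2) hom insert.prems(2)]]) blast
  show ?case
    by (rule serre_kernel_image[OF assms(1,2,2) hom insert.prems(2) kernel image])
qed

lemma serre_annihilated_of_submodule:
  assumes "serre_subcategory R S" "module R L" "module R M" "\<aa> \<subseteq> carrier R"
    and "f \<in> module_hom R L M" "inj_on f (carrier L)" "M\<lparr>carrier := annihilated \<aa> M\<rparr> \<in> S"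
  shows "L\<lparr>carrier := annihilated \<aa> L\<rparr> \<in> S"
proof (rule serre_injective[OF assms(1,7)])
  have sub: "annihilated \<aa> L \<subseteq> carrier L" by (auto simp: annihilated_def)
  show "module R (L\<lparr>carrier := annihilated \<aa> L\<rparr>)"
    using annihilated_submodule[OF assms(2,4)] assms(2)
    by (rule submodule.submodule_is_module)
  have "f x \<in> annihilated \<aa> M" if "x \<in> annihilated \<aa> L" for x
    using that assms(4) module_hom_closed[OF assms(5)] module_hom_zero[OF assms(2,3,5)]
    by (auto simp: annihilated_def subset_iff simp flip: module_hom_smult[OF assms(5)])
  then show "f \<in> module_hom R (L\<lparr>carrier := annihilated \<aa> L\<rparr>) (M\<lparr>carrier := annihilated \<aa> M\<rparr>)"
    using sub by (intro module_hom_restrict[OF assms(5)]) auto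
  show "inj_on f (carrier (L\<lparr>carrier := annihilated \<aa> L\<rparr>))"
    using assms(6) sub by (simp add: inj_on_subset)
qed

text \<open>
  The noetherian hypothesis enters here, through a finite set of generators of \<open>\<aa>\<close>. In terms of the
  long exact sequence, \<open>(0 :\<^sub>N \<aa>)\<close> is an extension of a submodule of \<open>Ext\<^sup>1(R/\<aa>, L)\<close> by a quotient of
  \<open>(0 :\<^sub>M \<aa>)\<close>; the proof obtains it instead as the image of its own preimage \<open>K\<close>, because \<open>K\<close> can be
  filtered by the generators.
\<close>

lemma serre_annihilated_of_quotient:
  assumes "noetherian_ring R" "serre_subcategory R S" "ideal \<aa> R"
    and "module R L" "module R M" "module R N" "short_exact R L f M g N"
    and "L \<in> S" "M\<lparr>carrier := annihilated \<aa> M\<rparr> \<in> S"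
  shows "N\<lparr>carrier := annihilated \<aa> N\<rparr> \<in> S"
proof -
  interpret L: module R L by fact
  interpret M: module R M by fact
  interpret N: module R N by fact
  have f: "f \<in> module_hom R L M" and g: "g \<in> module_hom R M N"
    and exact: "f ` carrier L = {x \<in> carrier M. g x = \<zero>\<^bsub>N\<^esub>}"
    and surj: "g ` carrier M = carrier N"
    using assms(7) by (auto simp: short_exact_def a_kernel_def')
  obtain A where A: "A \<subseteq> carrier R" "finite A" "\<aa> = Idl\<^bsub>R\<^esub> A"
    using noetherian_ring.finetely_gen[OF assms(1,3)] by blast
  have annM: "annihilated \<aa> M = annihilated A M"
    using annihilated_genideal[OF assms(5) A(1)] A(3) by simp
  have annN: "annihilated \<aa> N = annihilated A N"
    using annihilated_genideal[OF assms(6) A(1)] A(3) by simp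
  define K where "K = {x \<in> carrier M. g x \<in> annihilated A N}"
  have K: "submodule K R M"
    unfolding K_def
    by (rule submodule_preimage[OF assms(5,6) g M.carrier_is_submodule
          annihilated_submodule[OF assms(6) A(1)]])
  have T: "submodule (f ` carrier L) R M"
    by (rule submodule_image[OF assms(4,5) f L.carrier_is_submodule])
  have TS: "M\<lparr>carrier := f ` carrier L\<rparr> \<in> S"
    using assms(8) by (intro serre_image[OF assms(2,4,5) f L.carrier_is_submodule]) simp
  have "annihilated A M \<subseteq> K"
    using A(1) module_hom_closed[OF g] module_hom_zero[OF assms(5,6) g]
    by (auto simp: K_def annihilated_def subset_iff simp flip: module_hom_smult[OF g])
  then have "K \<inter> annihilated A M = annihilated \<aa> M"
    using annM by auto
  moreover have "r \<odot>\<^bsub>M\<^esub> x \<in> f ` carrier L" if "r \<in> A" "x \<in> K" for r x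
    using that A(1) module_hom_smult[OF g, of r x]
    by (auto simp: K_def annihilated_def exact)
  ultimately have "M\<lparr>carrier := K\<rparr> \<in> S"
    using serre_if_finite_multiplication_into_serre[OF assms(2,5) T TS A(2,1) K] assms(9) by simp
  then have "N\<lparr>carrier := g ` K\<rparr> \<in> S"
    by (rule serre_image[OF assms(2,5,6) g K])
  moreover have "g ` K = annihilated \<aa> N"
  proof -
    have "annihilated A N \<subseteq> g ` carrier M" using surj by (auto simp: annihilated_def)
    then show ?thesis unfolding annN K_def by auto
  qed
  ultimately show ?thesis by simp
qed

theorem theorem2p16:
  fixes R :: "('r, 'k) ring_scheme"
    and S :: "('r, 'm) module set"
    and \<aa> :: "'r set"
  assumes "cring R"
    and "noetherian_ring R"
    and "serre_subcategory R S"
    and "ideal \<aa> R"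
  shows "closed_under_extensions R (C_class R S \<aa>)"
proof -
  have aR: "\<aa> \<subseteq> carrier R"
    by (rule additive_subgroup.a_subset[OF ideal.axioms(1)[OF assms(4)]])
  have "C_condition R S \<aa> M"
    if L: "L \<in> C_class R S \<aa>" and N: "N \<in> C_class R S \<aa>" and M: "module R M"
      and ses: "short_exact R L f M g N" for L M N f g
    unfolding C_condition_def
  proof (intro impI, elim conjE)
    assume tors: "torsion R \<aa> M = carrier M" and annM: "M\<lparr>carrier := annihilated \<aa> M\<rparr> \<in> S"
    have mods: "module R L" "module R N" using L N by (auto simp: C_class_def Mods_def)
    have f: "f \<in> module_hom R L M" "inj_on f (carrier L)"
      and g: "g \<in> module_hom R M N" "g ` carrier M = carrier N"
      using ses by (auto simp: short_exact_def)
    have "torsion R \<aa> L = carrier L"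
      by (rule torsion_injective[OF assms(1,4) mods(1) M f tors])
    moreover have "L\<lparr>carrier := annihilated \<aa> L\<rparr> \<in> S"
      by (rule serre_annihilated_of_submodule[OF assms(3) mods(1) M aR f annM])
    ultimately have LS: "L \<in> S" using L by (simp add: C_class_def C_condition_def)
    have "torsion R \<aa> N = carrier N"
      by (rule torsion_surjective[OF assms(1,4) M mods(2) g tors])
    moreover have "N\<lparr>carrier := annihilated \<aa> N\<rparr> \<in> S"
      by (rule serre_annihilated_of_quotient[OF assms(2-4) mods(1) M mods(2) ses LS annM])
    ultimately have NS: "N \<in> S" using N by (simp add: C_class_def C_condition_def)
    show "M \<in> S" by (rule serre_extension[OF assms(3) LS NS M ses])
  qed
  then have "M \<in> C_class R S \<aa>"
    if "L \<in> C_class R S \<aa>" "N \<in> C_class R S \<aa>" "M \<in> Mods R" "short_exact R L f M g N"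
    for L M N f g
    using that unfolding C_class_def[of R S \<aa>] Mods_def mem_Collect_eq by blast
  then show ?thesis
    unfolding closed_under_extensions_def by blast
qed

end
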